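(* Let $n\geqslant 2$ and $d, r\geqslant 0$ be three integers with $(n-1)(d-1)\leqslant r\leqslant (n-1)d$. Then $$m_e\left(K_n^d, r\right) = \binom{nd-r}{d+1}+\left(r-\frac{(n-1)d}{2}\right)n^d.$$
   Context: All graphs are finite, undirected, without loops or multiple edges. $K_n$ is the complete graph on $n$ vertices. The Cartesian product $G\square H$ has vertex set $V(G)\times V(H)$, with $(g_1,h_1)$ and $(g_2,h_2)$ adjacent iff either $g_1=g_2$ and $h_1h_2\in E(H)$, or $g_1g_2\in E(G)$ and $h_1=h_2$. $K_n^d$ (the Hamming graph of dimension $d$) is the Cartesian product of $d$ copies of $K_n$; $K_n^0$ is the graph with a single vertex. The $r$-edge bootstrap percolation process on a graph $G$ (for an integer $r\geqslant 0$) starts with a set $E_0\subseteq E(G)$ of initially active edges; for each $i\geqslant 1$, $E_i$ is the union of $E_{i-1}$ and the set of all edges $e\in E(G)\setminus E_{i-1}$ having an endpoint that is incident to at least $r$ edges of $E_{i-1}$. The set $E_0$ is percolating if $E_t=E(G)$ for some $t\geqslant 0$. $m_e(G,r)$ is the minimum size of a percolating set in this process. Convention: $\binom{a}{b}=0$ if $b>a\geqslant 0$. *)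

theory Defs
  imports Complex_Main
begin

record 'a graph =
  verts :: "'a set"
  edges :: "'a set set"

definition simple_graph :: "'a graph \<Rightarrow> bool" where
  "simple_graph G \<longleftrightarrow> finite (verts G) \<and> (\<forall>e\<in>edges G. e \<subseteq> verts G \<and> card e = 2)"

definition complete_graph :: "nat \<Rightarrow> nat graph" where
  "complete_graph n = \<lparr>verts = {..<n}, edges = {e. e \<subseteq> {..<n} \<and> card e = 2}\<rparr>"

definition cartesian_product :: "'a graph \<Rightarrow> 'b graph \<Rightarrow> ('a \<times> 'b) graph" where
  "cartesian_product G H =
     \<lparr>verts = verts G \<times> verts H,
      edges = {{(g1, h1), (g2, h2)} | g1 h1 g2 h2.
        (g1, h1) \<in> verts G \<times> verts H \<and> (g2, h2) \<in> verts G \<times> verts H \<and>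
        (g1 = g2 \<and> {h1, h2} \<in> edges H \<or> {g1, g2} \<in> edges G \<and> h1 = h2)}\<rparr>"

definition relabel :: "('a \<Rightarrow> 'b) \<Rightarrow> 'a graph \<Rightarrow> 'b graph" where
  "relabel f G = \<lparr>verts = f ` verts G, edges = (`) f ` edges G\<rparr>"

text \<open>
  The vertices of the \<open>d\<close>-th Cartesian power are the lists of length \<open>d\<close>, so that all powers
  of \<open>G\<close> live in one type: the pair \<open>(x, xs)\<close> of \<open>G \<box> G\<^sup>d\<close> is renamed (injectively) to \<open>x # xs\<close>.
\<close>

primrec cartesian_power :: "'a graph \<Rightarrow> nat \<Rightarrow> 'a list graph" where
  "cartesian_power G 0 = \<lparr>verts = {[]}, edges = {}\<rparr>"
| "cartesian_power G (Suc d) =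
     relabel (\<lambda>(x, xs). x # xs) (cartesian_product G (cartesian_power G d))"

definition hamming_graph :: "nat \<Rightarrow> nat \<Rightarrow> nat list graph" where
  "hamming_graph n d = cartesian_power (complete_graph n) d"

primrec active_edges :: "'a graph \<Rightarrow> nat \<Rightarrow> 'a set set \<Rightarrow> nat \<Rightarrow> 'a set set" where
  "active_edges G r E0 0 = E0"
| "active_edges G r E0 (Suc i) = active_edges G r E0 i \<union>
     {e \<in> edges G - active_edges G r E0 i.
        \<exists>v\<in>e. r \<le> card {f \<in> active_edges G r E0 i. v \<in> f}}"

definition percolating :: "'a graph \<Rightarrow> nat \<Rightarrow> 'a set set \<Rightarrow> bool" where
  "percolating G r E0 \<longleftrightarrow> E0 \<subseteq> edges G \<and> (\<exists>t. active_edges G r E0 t = edges G)"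

definition m_e :: "'a graph \<Rightarrow> nat \<Rightarrow> nat" where
  "m_e G r = Min {card E0 | E0. percolating G r E0}"

lemma simple_graph_complete_graph: "simple_graph (complete_graph n)"
  by (auto simp: simple_graph_def complete_graph_def)

lemma simple_graph_cartesian_product:
  assumes "simple_graph G" "simple_graph H"
  shows "simple_graph (cartesian_product G H)"
proof -
  have "card {(g1, h1), (g2, h2)} = 2"
    if "g1 = g2 \<and> {h1, h2} \<in> edges H \<or> {g1, g2} \<in> edges G \<and> h1 = h2" for g1 h1 g2 h2
  proof -
    have "card {h1, h2} = 2 \<or> card {g1, g2} = 2"
      using that assms by (auto simp: simple_graph_def)
    then show ?thesis by (auto simp: card_insert_if split: if_splits)
  qed
  then show ?thesis
    using assms unfolding simple_graph_def cartesian_product_def by fastforce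
qed

lemma simple_graph_relabel:
  assumes "simple_graph G" "inj f"
  shows "simple_graph (relabel f G)"
  using assms
  by (auto simp: simple_graph_def relabel_def card_image[OF inj_on_subset[OF assms(2) subset_UNIV]])

lemma simple_graph_hamming_graph: "simple_graph (hamming_graph n d)"
  unfolding hamming_graph_def
proof (induction d)
  case 0
  show ?case by (simp add: simple_graph_def)
next
  case (Suc d)
  have "inj (\<lambda>(x, xs). x # xs)" by (auto simp: inj_on_def)
  with Suc show ?case
    by (auto intro!: simple_graph_relabel simple_graph_cartesian_product simple_graph_complete_graph)
qed

lemma finite_edges: "simple_graph G \<Longrightarrow> finite (edges G)"
  by (rule finite_subset[of _ "Pow (verts G)"]) (auto simp: simple_graph_def)

text \<open>The minimum in the definition of \<open>m_e\<close> is over a finite nonempty set.\<close>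

lemma m_e_set:
  assumes "simple_graph G"
  shows "finite {card E0 | E0. percolating G r E0}" "{card E0 | E0. percolating G r E0} \<noteq> {}"
proof -
  have "{card E0 | E0. percolating G r E0} \<subseteq> card ` Pow (edges G)"
    by (auto simp: percolating_def)
  then show "finite {card E0 | E0. percolating G r E0}"
    by (rule finite_subset) (simp add: finite_edges[OF assms])
  have "active_edges G r (edges G) 0 = edges G" by simp
  then have "percolating G r (edges G)" unfolding percolating_def by blast
  then show "{card E0 | E0. percolating G r E0} \<noteq> {}" by blast
qed

end

theory Submission
  imports Defs "HOL-Library.Nat_Bijection" "HOL-Computational_Algebra.Polynomial"
begin

text \<open>
  Put \<open>s = (n - 1)d - r\<close>: once at most \<open>s\<close> edges at a vertex are inactive, it activates them, so
  every vertex contributes at most \<open>s\<close> new edges. That alone would give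
  \<open>card E0 \<ge> |E| - s n\<^sup>d\<close>. The true minimum exceeds this by \<open>\<Sum>\<^sub>v max(0, s - |v|)\<close>, where \<open>|v|\<close> is the
  sum of the coordinates of the word \<open>v\<close>; for \<open>s \<le> n\<close> this sum counts the solutions of
  \<open>a\<^sub>0 + \<dots> + a\<^sub>d \<le> s - 1\<close> in natural numbers and hence is the binomial coefficient \<open>d + s\<close> over
  \<open>d + 1\<close> (\<open>sum_words_deficit\<close>).

  \<^bold>\<open>Upper bound.\<close> Process the vertices by decreasing \<open>|v|\<close>. Exactly \<open>|v|\<close> neighbours of \<open>v\<close>
  have a smaller coordinate sum, and when \<open>v\<close> is reached, its edges to all the other neighbours are
  active already. It suffices that \<open>|v| - s\<close> of the downward edges are active initially, and nothing
  if \<open>|v| < s\<close> (\<open>exists_percolating_set\<close>).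

  \<^bold>\<open>Lower bound.\<close> Give each edge \<open>uv\<close> a real label \<open>x\<^bsub>uv\<^esub>\<close> such that the labels at each vertex are
  distinct, and consider the functions \<open>f\<close> on the edges that satisfy, for every vertex \<open>v\<close> and every
  \<open>k < s\<close>, the equation \<open>\<Sum>\<^sub>u \<plusminus>f(uv) x\<^bsub>uv\<^esub>\<^sup>k = 0\<close>, with opposite signs at the two
  endpoints of an edge. By Vandermonde, such an \<open>f\<close> that vanishes on all but
  at most \<open>s\<close> edges at \<open>v\<close> vanishes on all edges at \<open>v\<close>. So vanishing spreads exactly as activity does, and a percolating set has at least as many elements as the
  solution space has dimensions. There are \<open>s n\<^sup>d\<close> equations, but they are dependent. A dependency
  is a family of polynomials \<open>q\<^sub>v\<close> of degree less than \<open>s\<close>, one for each vertex, with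
  \<open>q\<^sub>u(x\<^bsub>uv\<^esub>) = q\<^sub>v(x\<^bsub>uv\<^esub>)\<close> on each edge; linearly independent families raise the lower bound by their number
  (\<open>percolating_lower_bound\<close>).

  To find such families in the Hamming graph, place a line \<open>L\<^sub>v = {(t, \<ell>\<^bsub>1,v\<^sub>1\<^esub>(t), \<dots>, \<ell>\<^bsub>d,v\<^sub>d\<^esub>(t))}\<close> in
  \<open>(d + 1)\<close>-space for each vertex, where the \<open>\<ell>\<close> are affine functions. Lines of adjacent vertices meet,
  and \<open>x\<^bsub>uv\<^esub>\<close> is the parameter \<open>t\<close> of their common point. Any polynomial in \<open>d + 1\<close> variables of degree less than
  \<open>s\<close>, restricted to all the lines, is then a dependency. Restrictions of a Newton basis are
  independent by a triangularity argument, and the members used are indexed by the pairs \<open>(a, k)\<close> with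
  \<open>a\<close> a vertex and \<open>k < s - |a|\<close>, where \<open>k\<close> is the exponent of \<open>t\<close>. The number of these pairs is the
  sum above (\<open>newton_family_independent\<close>).
\<close>

section \<open>Homogeneous linear systems and Vandermonde systems\<close>

text \<open>
  Gaussian elimination: an equation with a nonzero coefficient is solved for the unknown at which it
  occurs, and the remaining system has one equation and one unknown less.
\<close>

lemma homogeneous_system_nontrivial_solution:
  fixes A :: "'i \<Rightarrow> 'j \<Rightarrow> real"
  assumes "finite I" "finite J" "card I < card J"
  shows "\<exists>z. (\<exists>j\<in>J. z j \<noteq> 0) \<and> (\<forall>i\<in>I. (\<Sum>j\<in>J. A i j * z j) = 0)"
  using assms
proof (induction I arbitrary: J A rule: finite_induct)
  case empty
  then have "J \<noteq> {}" by auto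
  then show ?case by (intro exI[of _ "\<lambda>_. 1"]) auto
next
  case (insert i I)
  show ?case
  proof (cases "\<forall>j\<in>J. A i j = 0")
    case True
    have "card I < card J" using insert by simp
    from insert.IH[OF insert.prems(1) this, of A] True show ?thesis by auto
  next
    case False
    then obtain j0 where j0: "j0 \<in> J" "A i j0 \<noteq> 0" by auto
    define J' where "J' = J - {j0}"
    have J: "J = insert j0 J'" "j0 \<notin> J'" "finite J'" using j0 insert.prems by (auto simp: J'_def)
    have "card I < card J'" using insert J by simp
    from insert.IH[OF J(3) this, of "\<lambda>k j. A k j - A k j0 * A i j / A i j0"]
    obtain z where z: "\<exists>j\<in>J'. z j \<noteq> 0"
      "\<forall>k\<in>I. (\<Sum>j\<in>J'. (A k j - A k j0 * A i j / A i j0) * z j) = 0" by auto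
    define y where "y = z(j0 := - (\<Sum>j\<in>J'. A i j * z j) / A i j0)"
    have y: "(\<Sum>j\<in>J. A k j * y j) = (\<Sum>j\<in>J'. (A k j - A k j0 * A i j / A i j0) * z j)" for k
    proof -
      have "(\<Sum>j\<in>J. A k j * y j) = A k j0 * y j0 + (\<Sum>j\<in>J'. A k j * y j)"
        using J by simp
      also have "(\<Sum>j\<in>J'. A k j * y j) = (\<Sum>j\<in>J'. A k j * z j)"
        using J(2) by (intro sum.cong) (auto simp: y_def)
      finally have split: "(\<Sum>j\<in>J. A k j * y j) = A k j0 * y j0 + (\<Sum>j\<in>J'. A k j * z j)" .
      have "y j0 = - (\<Sum>j\<in>J'. A i j * z j) / A i j0" by (simp add: y_def)
      then show ?thesis unfolding split
        by (simp add: left_diff_distrib right_diff_distrib sum_subtractf sum_distrib_left sum_divide_distrib mult_ac)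
    qed
    have "(\<Sum>j\<in>J. A k j * y j) = 0" if "k \<in> insert i I" for k
      using that z(2) j0(2) unfolding y by auto
    moreover have "\<exists>j\<in>J. y j \<noteq> 0" using z(1) J by (auto simp: y_def)
    ultimately show ?thesis by blast
  qed
qed

text \<open>
  The Vandermonde argument: the equations extend by linearity from the powers to all polynomials of
  degree less than \<open>s\<close>, and the Lagrange polynomial that vanishes at all nodes but \<open>x u\<close> isolates
  \<open>g u\<close>.
\<close>

lemma vanishing_power_sums_imp_zero:
  fixes g x :: "'a \<Rightarrow> real"
  assumes "finite U" "card U \<le> s" "inj_on x U"
    and sums: "\<And>k. k < s \<Longrightarrow> (\<Sum>u\<in>U. g u * x u ^ k) = 0"
    and "u \<in> U"
  shows "g u = 0"
proof -
  define q where "q = (\<Prod>v\<in>U - {u}. [:- x v, 1:])"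
  have "degree q \<le> card (U - {u})"
    unfolding q_def using degree_prod_sum_le[of "U - {u}" "\<lambda>v. [:- x v, 1:]"] assms(1) by simp
  moreover have "card (U - {u}) < card U" using assms(1,5) by (intro psubset_card_mono) auto
  ultimately have deg: "degree q < s" using assms(2) by linarith
  have "(\<Sum>v\<in>U. g v * poly q (x v)) = (\<Sum>v\<in>U. \<Sum>k\<le>degree q. coeff q k * (g v * x v ^ k))"
    by (simp add: poly_altdef sum_distrib_left mult_ac)
  also have "\<dots> = (\<Sum>k\<le>degree q. coeff q k * (\<Sum>v\<in>U. g v * x v ^ k))"
    by (subst sum.swap) (simp add: sum_distrib_left)
  also have "\<dots> = 0" using deg sums by (intro sum.neutral) auto
  finally have "(\<Sum>v\<in>U. g v * poly q (x v)) = 0" .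
  moreover have "(\<Sum>v\<in>U. g v * poly q (x v)) = g u * poly q (x u)"
    using assms(1,5) by (subst sum.remove[of _ u]) (auto intro!: sum.neutral simp: q_def poly_prod)
  moreover have "poly q (x u) \<noteq> 0"
    using assms(1,3,5) by (auto simp: q_def poly_prod inj_on_def)
  ultimately show ?thesis by simp
qed

section \<open>Neighbourhoods in simple graphs\<close>

definition nbrs :: "'a graph \<Rightarrow> 'a \<Rightarrow> 'a set" where
  "nbrs G v = {u. {v, u} \<in> edges G}"

lemma nbrs_subset_verts: "simple_graph G \<Longrightarrow> nbrs G v \<subseteq> verts G"
  by (auto simp: nbrs_def simple_graph_def)

lemma finite_nbrs: "simple_graph G \<Longrightarrow> finite (nbrs G v)"
  using nbrs_subset_verts finite_subset by (metis simple_graph_def)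

lemma nbrs_sym: "u \<in> nbrs G v \<longleftrightarrow> v \<in> nbrs G u"
  by (simp add: nbrs_def insert_commute)

lemma not_self_nbr: "simple_graph G \<Longrightarrow> v \<notin> nbrs G v"
  by (auto simp: nbrs_def simple_graph_def)

lemma edge_is_pair:
  assumes "simple_graph G" "e \<in> edges G" "v \<in> e"
  obtains u where "e = {v, u}" "u \<in> nbrs G v"
proof -
  have "card e = 2" using assms by (auto simp: simple_graph_def)
  then obtain a b where "e = {a, b}" by (auto simp: card_2_iff)
  with assms have "\<exists>u. e = {v, u}" by blast
  with assms that show ?thesis by (auto simp: nbrs_def)
qed

lemma edge_has_endpoint:
  assumes "simple_graph G" "e \<in> edges G"
  obtains v where "v \<in> e" "v \<in> verts G"
proof -
  have "e \<subseteq> verts G" "e \<noteq> {}" using assms by (auto simp: simple_graph_def)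
  with that show ?thesis by blast
qed

lemma inj_pair_with: "inj_on (\<lambda>u. {v, u}) S"
  by (auto simp: inj_on_def doubleton_eq_iff)

lemma card_edges_at:
  assumes "simple_graph G" "F \<subseteq> edges G"
  shows "card {f \<in> F. v \<in> f} = card {u \<in> nbrs G v. {v, u} \<in> F}"
proof -
  have "{f \<in> F. v \<in> f} = (\<lambda>u. {v, u}) ` {u \<in> nbrs G v. {v, u} \<in> F}"
    using assms by (auto elim!: edge_is_pair[of G])
  then show ?thesis by (simp add: card_image inj_pair_with)
qed

lemma active_edges_subset_edges: "E0 \<subseteq> edges G \<Longrightarrow> active_edges G r E0 t \<subseteq> edges G"
  by (induction t) auto

section \<open>The linear-algebraic lower bound\<close>

text \<open>
  A vertex that activates its remaining edges has at most \<open>s\<close> of them, so its \<open>s\<close> equations, with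
  all other terms zero, force \<open>f\<close> to vanish there too. Thus zeros spread along the process.
\<close>

lemma edge_function_vanishes:
  fixes \<epsilon> x :: "'a \<Rightarrow> 'a \<Rightarrow> real" and f :: "'a set \<Rightarrow> real"
  assumes G: "simple_graph G" and perc: "percolating G r E0"
    and deg: "\<And>v. v \<in> verts G \<Longrightarrow> card (nbrs G v) \<le> r + s"
    and inj: "\<And>v. v \<in> verts G \<Longrightarrow> inj_on (x v) (nbrs G v)"
    and sign: "\<And>v u. u \<in> nbrs G v \<Longrightarrow> \<epsilon> v u \<noteq> 0"
    and sums: "\<And>v k. v \<in> verts G \<Longrightarrow> k < s \<Longrightarrow>
                 (\<Sum>u\<in>nbrs G v. \<epsilon> v u * f {v, u} * x v u ^ k) = 0"
    and init: "\<And>e. e \<in> E0 \<Longrightarrow> f e = 0"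
    and "e \<in> edges G"
  shows "f e = 0"
proof -
  have E0: "E0 \<subseteq> edges G" using perc by (simp add: percolating_def)
  have "\<forall>e\<in>active_edges G r E0 t. f e = 0" for t
  proof (induction t)
    case (Suc t)
    let ?F = "active_edges G r E0 t"
    have "f e = 0" if e: "e \<in> edges G - ?F" "v \<in> e" and r: "r \<le> card {f \<in> ?F. v \<in> f}" for e v
    proof -
      obtain u where u: "e = {v, u}" "u \<in> nbrs G v" using edge_is_pair[OF G] e by blast
      have v: "v \<in> verts G" using e G by (auto simp: simple_graph_def)
      define U where "U = {u \<in> nbrs G v. {v, u} \<notin> ?F}"
      have fin: "finite (nbrs G v)" by (rule finite_nbrs[OF G])
      have "card U = card (nbrs G v) - card {u \<in> nbrs G v. {v, u} \<in> ?F}"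
        unfolding U_def using fin
        by (subst card_Diff_subset[symmetric]) (auto intro!: arg_cong[of _ _ card])
      then have card: "card U \<le> s"
        using r deg[OF v] card_edges_at[OF G active_edges_subset_edges[OF E0], where v = v] by simp
      have "(\<Sum>u\<in>U. \<epsilon> v u * f {v, u} * x v u ^ k) = 0" if "k < s" for k
      proof -
        have "(\<Sum>u\<in>U. \<epsilon> v u * f {v, u} * x v u ^ k)
              = (\<Sum>u\<in>nbrs G v. \<epsilon> v u * f {v, u} * x v u ^ k)"
          using fin Suc by (intro sum.mono_neutral_left) (auto simp: U_def)
        with sums[OF v that] show ?thesis by simp
      qed
      moreover have "u \<in> U" "finite U" using u e fin by (auto simp: U_def)
      moreover have "inj_on (x v) U" using inj[OF v] by (rule inj_on_subset) (auto simp: U_def)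
      ultimately have "\<epsilon> v u * f {v, u} = 0"
        using card
        by (intro vanishing_power_sums_imp_zero
            [where g = "\<lambda>u. \<epsilon> v u * f {v, u}" and x = "x v" and s = s and U = U])
      then show ?thesis using sign u by simp
    qed
    then show ?case using Suc by auto
  qed (simp add: init)
  moreover obtain t where "active_edges G r E0 t = edges G"
    using perc by (auto simp: percolating_def)
  ultimately show ?thesis using assms(8) by metis
qed

text \<open>
  The families \<open>p c\<close> are the dependencies among the vertex equations. Instead of computing
  dimensions, take the values of \<open>f\<close> outside \<open>E0\<close> together with one coefficient \<open>z c\<close> per family as
  unknowns, and require at each vertex \<open>v\<close> and for each \<open>k < s\<close> that the left side \<open>Y v k\<close> of the vertex
  equation cancels the \<open>k\<close>-th coefficient of the combined polynomial \<open>q v = \<Sum>\<^sub>c z\<^sub>c p\<^sub>c(v)\<close>. If the bound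
  failed, there would be a nontrivial solution. But \<open>q\<close> is a dependency, hence orthogonal to
  \<open>Y\<close>; as \<open>Y = -q\<close>, both are zero. Then \<open>z = 0\<close> by independence and \<open>f = 0\<close> because \<open>E0\<close>
  percolates.
\<close>

lemma percolating_lower_bound:
  fixes x :: "'a \<Rightarrow> 'a \<Rightarrow> real" and p :: "'c \<Rightarrow> 'a \<Rightarrow> real poly"
  assumes G: "simple_graph G" and perc: "percolating G r E0"
    and deg: "\<And>v. v \<in> verts G \<Longrightarrow> card (nbrs G v) \<le> r + s"
    and inj: "\<And>v. v \<in> verts G \<Longrightarrow> inj_on (x v) (nbrs G v)"
    and sym: "\<And>u v. x u v = x v u"
    and C: "finite C"
    and deg_p: "\<And>c v. c \<in> C \<Longrightarrow> v \<in> verts G \<Longrightarrow> degree (p c v) < s"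
    and agree: "\<And>c u v. c \<in> C \<Longrightarrow> {u, v} \<in> edges G \<Longrightarrow> poly (p c u) (x u v) = poly (p c v) (x u v)"
    and indep: "\<And>z. (\<And>v. v \<in> verts G \<Longrightarrow> (\<Sum>c\<in>C. smult (z c) (p c v)) = 0) \<Longrightarrow> \<forall>c\<in>C. z c = 0"
  shows "card (edges G) + card C \<le> s * card (verts G) + card E0"
proof (rule ccontr)
  assume neg: "\<not> ?thesis"
  have E0: "E0 \<subseteq> edges G" using perc by (simp add: percolating_def)
  have finE: "finite (edges G)" by (rule finite_edges[OF G])
  have finV: "finite (verts G)" using G by (simp add: simple_graph_def)
  have finN: "finite (nbrs G v)" for v by (rule finite_nbrs[OF G])
  \<comment> \<open>An arbitrary numbering of the vertices supplies the opposite signs at the ends of an edge.\<close>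
  obtain h :: "'a \<Rightarrow> nat" where h: "inj_on h (verts G)"
    using finite_imp_inj_to_nat_seg[OF finV] by blast
  define \<epsilon> :: "'a \<Rightarrow> 'a \<Rightarrow> real" where "\<epsilon> u v = (if h u < h v then 1 else -1)" for u v
  have \<epsilon>_sym: "\<epsilon> u v = - \<epsilon> v u" if "u \<in> nbrs G v" for u v
  proof -
    have "u \<in> verts G" "v \<in> verts G" "u \<noteq> v"
      using that nbrs_sym[of u G v] nbrs_subset_verts[OF G] not_self_nbr[OF G] by blast+
    then have "h u \<noteq> h v" using h by (auto simp: inj_on_def)
    then show ?thesis by (auto simp: \<epsilon>_def)
  qed
  define A :: "'a \<times> nat \<Rightarrow> 'a set + 'c \<Rightarrow> real" where
    "A = (\<lambda>(v, k) j. case j of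
        Inl e \<Rightarrow> \<Sum>u\<in>nbrs G v. if {v, u} = e then \<epsilon> v u * x v u ^ k else 0
      | Inr c \<Rightarrow> coeff (p c v) k)"
  have "card (verts G \<times> {..<s}) < card ((edges G - E0) <+> C)"
    using neg finE C E0 finite_subset[OF E0 finE] card_mono[OF finE E0]
    by (simp add: card_Plus card_Diff_subset card_cartesian_product mult.commute)
  from homogeneous_system_nontrivial_solution[OF _ _ this, of A]
  obtain z where z: "\<exists>j\<in>(edges G - E0) <+> C. z j \<noteq> 0"
    "\<And>v k. v \<in> verts G \<Longrightarrow> k < s \<Longrightarrow> (\<Sum>j\<in>(edges G - E0) <+> C. A (v, k) j * z j) = 0"
    using finV finE C by auto
  define f where "f e = (if e \<in> edges G - E0 then z (Inl e) else 0)" for e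
  define q where "q v = (\<Sum>c\<in>C. smult (z (Inr c)) (p c v))" for v
  define Y where "Y v k = (\<Sum>u\<in>nbrs G v. \<epsilon> v u * f {v, u} * x v u ^ k)" for v k
  have Yq: "Y v k + coeff (q v) k = 0" if "v \<in> verts G" "k < s" for v k
  proof -
    have "(\<Sum>e\<in>edges G - E0. A (v, k) (Inl e) * z (Inl e))
        = (\<Sum>u\<in>nbrs G v. \<Sum>e\<in>edges G - E0. if {v, u} = e then \<epsilon> v u * x v u ^ k * z (Inl e) else 0)"
      by (subst sum.swap) (auto simp: A_def sum_distrib_right intro!: sum.cong)
    also have "\<dots> = Y v k"
      unfolding Y_def using finE by (intro sum.cong) (auto simp: f_def)
    finally have "(\<Sum>j\<in>(edges G - E0) <+> C. A (v, k) j * z j) = Y v k + coeff (q v) k"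
      using finE C by (simp add: sum.Plus A_def q_def coeff_sum mult.commute)
    with z(2)[OF that] show ?thesis by simp
  qed
  have q_agree: "poly (q u) (x u v) = poly (q v) (x u v)" if "{u, v} \<in> edges G" for u v
    using agree[OF _ that] by (simp add: q_def poly_sum)
  have deg_q: "degree (q v) < s \<or> q v = 0" if "v \<in> verts G" for v
  proof (cases "C = {}")
    case False
    then show ?thesis
      unfolding q_def using deg_p that C
      by (intro disjI1 degree_sum_less) (auto intro: order_le_less_trans[OF degree_smult_le] gr_zeroI)
  qed (simp add: q_def)
  have poly_q: "poly (q v) y = (\<Sum>k<s. coeff (q v) k * y ^ k)" if "v \<in> verts G" for v y
    using deg_q[OF that]
  proof
    assume "degree (q v) < s"
    then show ?thesis
      unfolding poly_altdef by (intro sum.mono_neutral_left) (auto simp: coeff_eq_0)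
  qed simp
  \<comment> \<open>Orthogonality of \<open>q\<close> and \<open>Y\<close>: the two orientations of each edge contribute opposite terms.\<close>
  define S where "S = (\<Sum>(v, u)\<in>Sigma (verts G) (nbrs G). \<epsilon> v u * f {v, u} * poly (q v) (x v u))"
  have "(\<Sum>v\<in>verts G. \<Sum>k<s. coeff (q v) k * Y v k)
      = (\<Sum>v\<in>verts G. \<Sum>u\<in>nbrs G v. \<epsilon> v u * f {v, u} * poly (q v) (x v u))"
    by (intro sum.cong refl, simp add: poly_q Y_def sum_distrib_left mult_ac, rule sum.swap)
  also have "\<dots> = S" unfolding S_def using finV finN by (subst sum.Sigma) auto
  also have "S = - S"
  proof -
    have swap: "bij_betw prod.swap (Sigma (verts G) (nbrs G)) (Sigma (verts G) (nbrs G))"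
      using nbrs_subset_verts[OF G, THEN subsetD] nbrs_sym[of _ G]
      by (intro bij_betw_byWitness[where f' = prod.swap]) auto
    have "S = (\<Sum>(v, u)\<in>Sigma (verts G) (nbrs G). \<epsilon> u v * f {u, v} * poly (q u) (x u v))"
      unfolding S_def by (subst sum.reindex_bij_betw[OF swap, symmetric]) (simp add: case_prod_unfold)
    also have "\<dots> = (\<Sum>(v, u)\<in>Sigma (verts G) (nbrs G). - (\<epsilon> v u * f {v, u} * poly (q v) (x v u)))"
    proof (intro sum.cong refl, clarify)
      fix v u assume u: "u \<in> nbrs G v"
      then have "{u, v} \<in> edges G" by (simp add: nbrs_def insert_commute)
      from q_agree[OF this] \<epsilon>_sym[OF u] sym[of u v]
      show "\<epsilon> u v * f {u, v} * poly (q u) (x u v) = - (\<epsilon> v u * f {v, u} * poly (q v) (x v u))"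
        by (simp add: insert_commute)
    qed
    also have "\<dots> = - S" unfolding S_def by (simp add: case_prod_unfold sum_negf)
    finally show ?thesis .
  qed
  finally have "(\<Sum>v\<in>verts G. \<Sum>k<s. coeff (q v) k * Y v k) = 0"
    using \<open>S = - S\<close> by simp
  moreover have "(\<Sum>v\<in>verts G. \<Sum>k<s. coeff (q v) k * Y v k)
      = - (\<Sum>v\<in>verts G. \<Sum>k<s. (coeff (q v) k)\<^sup>2)"
    unfolding sum_negf[symmetric] using Yq
    by (intro sum.cong refl) (auto simp: power2_eq_square eq_neg_iff_add_eq_0 simp flip: distrib_left)
  ultimately have "\<forall>v\<in>verts G. (\<Sum>k<s. (coeff (q v) k)\<^sup>2) = 0"
    using finV by (simp add: sum_nonneg_eq_0_iff sum_nonneg)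
  then have coeff_q: "coeff (q v) k = 0" if "v \<in> verts G" "k < s" for v k
    using that by (simp add: sum_nonneg_eq_0_iff)
  then have "q v = 0" if "v \<in> verts G" for v
    using deg_q[OF that] that by (metis leading_coeff_0_iff)
  then have "\<forall>c\<in>C. z (Inr c) = 0"
    using indep[of "\<lambda>c. z (Inr c)"] by (simp add: q_def)
  moreover have "f e = 0" if "e \<in> edges G" for e
  proof (rule edge_function_vanishes[OF G perc deg inj _ _ _ that, where \<epsilon> = \<epsilon>])
    show "(\<Sum>u\<in>nbrs G v. \<epsilon> v u * f {v, u} * x v u ^ k) = 0" if "v \<in> verts G" "k < s" for v k
      using Yq[OF that] coeff_q[OF that] by (simp add: Y_def)
  qed (auto simp: \<epsilon>_def f_def)
  then have "\<forall>e\<in>edges G - E0. z (Inl e) = 0" by (metis DiffD1 f_def)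
  ultimately show False using z(1) by auto
qed

section \<open>Percolating sets from a vertex ordering\<close>

definition lower_nbrs :: "'a graph \<Rightarrow> ('a \<Rightarrow> nat) \<Rightarrow> 'a \<Rightarrow> 'a set" where
  "lower_nbrs G w v = {u \<in> nbrs G v. w u < w v}"

lemma inj_on_downward_edges: "inj_on (\<lambda>(v, u). {v, u}) (Sigma V (lower_nbrs G w))"
  by (auto simp: inj_on_def lower_nbrs_def doubleton_eq_iff)

lemma card_downward_edges:
  assumes G: "simple_graph G" and T: "\<And>v. v \<in> verts G \<Longrightarrow> T v \<subseteq> lower_nbrs G w v"
  shows "card ((\<lambda>(v, u). {v, u}) ` Sigma (verts G) T) = (\<Sum>v\<in>verts G. card (T v))"
proof -
  have "finite (T v)" if "v \<in> verts G" for v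
    using T[OF that] finite_nbrs[OF G, of v] by (auto simp: lower_nbrs_def intro: finite_subset)
  moreover have "inj_on (\<lambda>(v, u). {v, u}) (Sigma (verts G) T)"
    using T by (intro inj_on_subset[OF inj_on_downward_edges[of "verts G" G w]]) auto
  ultimately show ?thesis
    using G by (subst card_image) (auto simp: simple_graph_def intro!: card_SigmaI)
qed

lemma card_edges_eq_sum_lower:
  assumes G: "simple_graph G" and w: "\<And>u v. {u, v} \<in> edges G \<Longrightarrow> w u \<noteq> w v"
  shows "card (edges G) = (\<Sum>v\<in>verts G. card (lower_nbrs G w v))"
proof -
  have "edges G = (\<lambda>(v, u). {v, u}) ` Sigma (verts G) (lower_nbrs G w)"
  proof (intro equalityI subsetI)
    fix e assume e: "e \<in> edges G"
    then obtain v where v: "v \<in> e" "v \<in> verts G" using edge_has_endpoint[OF G] by blast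
    then obtain u where u: "e = {v, u}" "u \<in> nbrs G v" using edge_is_pair[OF G e] by blast
    have "w v < w u \<or> w u < w v" using w e u by (metis linorder_neqE_nat)
    then show "e \<in> (\<lambda>(v, u). {v, u}) ` Sigma (verts G) (lower_nbrs G w)"
    proof
      assume "w u < w v"
      then show ?thesis using u v by (force simp: lower_nbrs_def)
    next
      assume "w v < w u"
      then have "(u, v) \<in> Sigma (verts G) (lower_nbrs G w)"
        using u nbrs_sym[of u G v] nbrs_subset_verts[OF G] by (auto simp: lower_nbrs_def)
      then show ?thesis using u by (force simp: insert_commute)
    qed
  qed (auto simp: lower_nbrs_def nbrs_def)
  then show ?thesis using card_downward_edges[OF G, of "lower_nbrs G w" w] by simp
qed

text \<open>
  The vertices are processed by decreasing \<open>w\<close>. Choosing all but \<open>s\<close> of the downward edges at each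
  vertex suffices, since the upward edges are active when the vertex is reached.
\<close>

lemma exists_percolating_set:
  assumes G: "simple_graph G" and w: "\<And>u v. {u, v} \<in> edges G \<Longrightarrow> w u \<noteq> w v"
    and deg: "\<And>v. v \<in> verts G \<Longrightarrow> r + s \<le> card (nbrs G v)"
  shows "\<exists>E0. percolating G r E0 \<and> card E0 = (\<Sum>v\<in>verts G. card (lower_nbrs G w v) - s)"
proof -
  have finV: "finite (verts G)" using G by (simp add: simple_graph_def)
  have "\<exists>T. T \<subseteq> lower_nbrs G w v \<and> card T = card (lower_nbrs G w v) - s" for v
    by (meson diff_le_self obtain_subset_with_card_n)
  then obtain T where T: "\<And>v. T v \<subseteq> lower_nbrs G w v"
    "\<And>v. card (T v) = card (lower_nbrs G w v) - s" by metis
  define E0 where "E0 = (\<lambda>(v, u). {v, u}) ` Sigma (verts G) T"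
  have E0: "E0 \<subseteq> edges G" using T(1) by (fastforce simp: E0_def lower_nbrs_def nbrs_def)
  define M where "M = Max (w ` verts G)"
  have M: "w v \<le> M" if "v \<in> verts G" for v using that finV by (simp add: M_def)
  \<comment> \<open>After \<open>t\<close> steps all vertices of the \<open>t\<close> highest levels have only active edges.\<close>
  have saturated: "\<forall>v\<in>verts G. M < w v + t \<longrightarrow> (\<forall>u\<in>nbrs G v. {v, u} \<in> active_edges G r E0 t)" for t
  proof (induction t)
    case 0
    then show ?case using M by force
  next
    case (Suc t)
    let ?F = "active_edges G r E0 t"
    have "{v, u} \<in> active_edges G r E0 (Suc t)"
      if v: "v \<in> verts G" "M < w v + Suc t" and u: "u \<in> nbrs G v" for v u
    proof -
      let ?L = "lower_nbrs G w v"
      have fin: "finite (nbrs G v)" by (rule finite_nbrs[OF G])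
      have sub: "T v \<union> (nbrs G v - ?L) \<subseteq> {y \<in> nbrs G v. {v, y} \<in> ?F}"
      proof (intro Un_least subsetI)
        fix y assume "y \<in> T v"
        moreover have "E0 \<subseteq> ?F" by (induction t) auto
        ultimately show "y \<in> {y \<in> nbrs G v. {v, y} \<in> ?F}"
          using T(1)[of v] v by (auto simp: E0_def lower_nbrs_def)
      next
        fix y assume y: "y \<in> nbrs G v - ?L"
        then have "w v < w y" using w[of v y] by (auto simp: lower_nbrs_def nbrs_def)
        then have "{y, v} \<in> ?F"
          using Suc v y nbrs_subset_verts[OF G, of v] nbrs_sym[of y G v] by auto
        then show "y \<in> {y \<in> nbrs G v. {v, y} \<in> ?F}" using y by (simp add: insert_commute)
      qed
      have L: "?L \<subseteq> nbrs G v" by (auto simp: lower_nbrs_def)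
      have "r \<le> card (T v) + card (nbrs G v - ?L)"
        using deg[OF v(1)] T(2)[of v] L fin card_mono[OF fin L]
        by (simp add: card_Diff_subset finite_subset)
      also have "\<dots> = card (T v \<union> (nbrs G v - ?L))"
      proof (rule card_Un_disjoint[symmetric])
        show "finite (T v)" using T(1)[of v] L fin by (meson finite_subset)
      qed (use T(1)[of v] fin in auto)
      also have "\<dots> \<le> card {y \<in> nbrs G v. {v, y} \<in> ?F}"
        using sub fin by (intro card_mono) auto
      also have "\<dots> = card {f \<in> ?F. v \<in> f}"
        by (rule card_edges_at[OF G active_edges_subset_edges[OF E0], symmetric])
      finally show ?thesis using u by (auto simp: nbrs_def)
    qed
    then show ?case by blast
  qed
  have "edges G \<subseteq> active_edges G r E0 (Suc M)"
  proof
    fix e assume e: "e \<in> edges G"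
    then obtain v where v: "v \<in> e" "v \<in> verts G" using edge_has_endpoint[OF G] by blast
    then obtain u where "e = {v, u}" "u \<in> nbrs G v" using edge_is_pair[OF G e] by blast
    with saturated[of "Suc M"] v show "e \<in> active_edges G r E0 (Suc M)" by simp
  qed
  then have "active_edges G r E0 (Suc M) = edges G"
    by (intro subset_antisym active_edges_subset_edges[OF E0])
  then have "percolating G r E0" using E0 unfolding percolating_def by blast
  moreover have "card E0 = (\<Sum>v\<in>verts G. card (lower_nbrs G w v) - s)"
    unfolding E0_def using card_downward_edges[OF G, of T w] T by simp
  ultimately show ?thesis by blast
qed

section \<open>Structure of Hamming graphs\<close>

definition words :: "nat \<Rightarrow> nat \<Rightarrow> nat list set" where
  "words n d = {xs. length xs = d \<and> set xs \<subseteq> {..<n}}"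

lemma words_0: "words n 0 = {[]}"
  by (auto simp: words_def)

lemma words_Suc: "words n (Suc d) = (\<lambda>(x, xs). x # xs) ` ({..<n} \<times> words n d)"
  by (auto simp: words_def length_Suc_conv image_iff)

lemma Cons_in_words: "x # xs \<in> words n (Suc d) \<longleftrightarrow> x < n \<and> xs \<in> words n d"
  by (simp add: words_def) blast

lemma finite_words: "finite (words n d)"
  by (induction d) (auto simp: words_0 words_Suc)

lemma sum_words_Suc: "(\<Sum>v\<in>words n (Suc d). g v) = (\<Sum>x<n. \<Sum>v\<in>words n d. g (x # v))"
  unfolding words_Suc
  by (subst sum.reindex) (auto simp: inj_on_def sum.cartesian_product case_prod_unfold)

lemma card_words: "card (words n d) = n ^ d"
proof (induction d)
  case (Suc d)
  have "inj_on (\<lambda>(x, xs). x # xs) ({..<n} \<times> words n d)" by (auto simp: inj_on_def)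
  then show ?case unfolding words_Suc using Suc by (simp add: card_image card_cartesian_product)
qed (simp add: words_0)

lemma verts_hamming_graph: "verts (hamming_graph n d) = words n d"
  unfolding hamming_graph_def
  by (induction d)
    (auto simp: words_0 words_Suc relabel_def cartesian_product_def complete_graph_def)

lemma image_Collect4:
  "f ` {T a b c d | a b c d. P a b c d} = {f (T a b c d) | a b c d. P a b c d}"
  by blast

lemma edges_hamming_graph_Suc:
  "edges (hamming_graph n (Suc d)) =
     {{g # h1, g # h2} | g h1 h2. g < n \<and> {h1, h2} \<in> edges (hamming_graph n d)} \<union>
     {{g1 # h, g2 # h} | g1 g2 h. g1 < n \<and> g2 < n \<and> g1 \<noteq> g2 \<and> h \<in> words n d}" (is "?E = ?A \<union> ?B")
proof -
  have V: "h1 \<in> words n d \<and> h2 \<in> words n d" if "{h1, h2} \<in> edges (hamming_graph n d)" for h1 h2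
    using that simple_graph_hamming_graph[of n d]
    by (auto simp: simple_graph_def verts_hamming_graph)
  have K: "{g1, g2} \<in> edges (complete_graph n) \<longleftrightarrow> g1 < n \<and> g2 < n \<and> g1 \<noteq> g2" for g1 g2
    by (auto simp: complete_graph_def card_insert_if)
  have Kv: "verts (complete_graph n) = {..<n}" by (simp add: complete_graph_def)
  have "?E = {{g1 # h1, g2 # h2} | g1 h1 g2 h2. g1 < n \<and> g2 < n \<and> h1 \<in> words n d \<and> h2 \<in> words n d \<and>
      (g1 = g2 \<and> {h1, h2} \<in> edges (hamming_graph n d) \<or> g1 \<noteq> g2 \<and> h1 = h2)}" (is "_ = ?M")
  proof -
    have "?E = (`) (\<lambda>(x, xs). x # xs) `
        edges (cartesian_product (complete_graph n) (hamming_graph n d))"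
      by (simp add: hamming_graph_def relabel_def)
    also have "\<dots> = ?M"
      unfolding cartesian_product_def Kv K verts_hamming_graph graph.simps image_Collect4 by auto
    finally show ?thesis .
  qed
  also have "\<dots> = ?A \<union> ?B" using V by blast
  finally show ?thesis .
qed

lemma edges_hamming_graph:
  "edges (hamming_graph n d) =
     {{v, v[i := b]} | v i b. v \<in> words n d \<and> i < d \<and> b < n \<and> b \<noteq> v ! i}"
proof (induction d)
  case 0
  then show ?case by (simp add: hamming_graph_def)
next
  case (Suc d)
  show ?case (is "?E = ?R")
  proof (intro equalityI subsetI)
    have R: "{v, v[i := b]} \<in> ?R" if "v \<in> words n (Suc d)" "i < Suc d" "b < n" "b \<noteq> v ! i" for v i b
      using that by blast
    fix e assume "e \<in> ?E"
    then consider (tail) g h1 h2 where "e = {g # h1, g # h2}" "g < n"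
        "{h1, h2} \<in> edges (hamming_graph n d)"
      | (head) g1 g2 h where "e = {g1 # h, g2 # h}" "g1 < n" "g2 < n" "g1 \<noteq> g2" "h \<in> words n d"
      unfolding edges_hamming_graph_Suc by blast
    then show "e \<in> ?R"
    proof cases
      case tail
      then obtain v i b where v: "{h1, h2} = {v, v[i := b]}" "v \<in> words n d" "i < d" "b < n" "b \<noteq> v ! i"
        using Suc by (smt (verit) mem_Collect_eq)
      have "e = (#) g ` {h1, h2}" using tail by simp
      then have "e = {g # v, (g # v)[Suc i := b]}" using v by simp
      moreover have "g # v \<in> words n (Suc d)" using tail v by (simp add: Cons_in_words)
      ultimately show ?thesis using v R[of "g # v" "Suc i" b] by simp
    next
      case head
      then have "g1 # h \<in> words n (Suc d)" "e = {g1 # h, (g1 # h)[0 := g2]}" "g2 \<noteq> (g1 # h) ! 0"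
        by (simp_all add: Cons_in_words)
      then show ?thesis using head(3) R[of "g1 # h" 0 g2] by simp
    qed
  next
    fix e assume "e \<in> ?R"
    then obtain v i b where v: "e = {v, v[i := b]}" "v \<in> words n (Suc d)" "i < Suc d" "b < n" "b \<noteq> v ! i"
      by blast
    obtain g h where gh: "v = g # h" "g < n" "h \<in> words n d" using v(2) by (auto simp: words_Suc)
    show "e \<in> ?E"
    proof (cases i)
      case 0
      then have "e = {g # h, b # h}" "g \<noteq> b" using v gh by auto
      then show ?thesis unfolding edges_hamming_graph_Suc using v(4) gh by blast
    next
      case (Suc j)
      then have "j < d" "b \<noteq> h ! j" and e: "e = {g # h, g # h[j := b]}" using v gh by auto
      then have "{h, h[j := b]} \<in> edges (hamming_graph n d)" using Suc.IH v(4) gh(3) by blast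
      then show ?thesis unfolding edges_hamming_graph_Suc using e gh(2) by blast
    qed
  qed
qed

lemma nbrs_hamming_graph:
  assumes v: "v \<in> words n d"
  shows "nbrs (hamming_graph n d) v = (\<lambda>(i, b). v[i := b]) ` (SIGMA i:{..<d}. {..<n} - {v ! i})"
    (is "_ = ?R")
proof (intro equalityI subsetI)
  fix u assume "u \<in> nbrs (hamming_graph n d) v"
  then obtain v' i b where *: "{v, u} = {v', v'[i := b]}" "v' \<in> words n d" "i < d" "b < n" "b \<noteq> v' ! i"
    by (auto simp: nbrs_def edges_hamming_graph)
  from *(1) consider "v = v'" "u = v'[i := b]" | "v = v'[i := b]" "u = v'"
    by (auto simp: doubleton_eq_iff)
  then show "u \<in> ?R"
  proof cases
    case 1
    then show ?thesis using * by force
  next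
    case 2
    have "length v' = d" "v' ! i < n" using *(2,3) by (auto simp: words_def subset_iff)
    then have "u = v[i := v' ! i]" "v ! i = b" using 2 * by auto
    moreover have "(i, v' ! i) \<in> (SIGMA i:{..<d}. {..<n} - {v ! i})"
      using * \<open>v ! i = b\<close> \<open>v' ! i < n\<close> by auto
    ultimately show ?thesis by force
  qed
next
  fix u assume "u \<in> ?R"
  then show "u \<in> nbrs (hamming_graph n d) v" using v by (auto simp: nbrs_def edges_hamming_graph)
qed

lemma inj_on_list_update:
  assumes "length v = d"
  shows "inj_on (\<lambda>(i, b). v[i := b]) (SIGMA i:{..<d}. - {v ! i})"
proof (rule inj_onI)
  fix p q assume p: "p \<in> (SIGMA i:{..<d}. - {v ! i})" and q: "q \<in> (SIGMA i:{..<d}. - {v ! i})"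
    and eq: "(case p of (i, b) \<Rightarrow> v[i := b]) = (case q of (i, b) \<Rightarrow> v[i := b])"
  obtain i b j c where pq: "p = (i, b)" "q = (j, c)" by (metis surj_pair)
  then have *: "i < d" "j < d" "b \<noteq> v ! i" "c \<noteq> v ! j" "v[i := b] = v[j := c]"
    using p q eq by auto
  have "v[j := c] ! i = b" using * assms by (metis nth_list_update_eq)
  then have "i = j" using *(3) by (metis nth_list_update_neq)
  moreover from this have "b = c" using \<open>v[j := c] ! i = b\<close> * assms by simp
  ultimately show "p = q" by (simp add: pq)
qed

lemma card_nbrs_hamming_graph:
  assumes v: "v \<in> words n d"
  shows "card (nbrs (hamming_graph n d) v) = d * (n - 1)"
proof -
  have len: "length v = d" and lt: "i < d \<Longrightarrow> v ! i < n" for i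
    using v by (auto simp: words_def subset_iff)
  have "card (nbrs (hamming_graph n d) v) = card (SIGMA i:{..<d}. {..<n} - {v ! i})"
    unfolding nbrs_hamming_graph[OF v]
    by (intro card_image inj_on_subset[OF inj_on_list_update[OF len]]) auto
  also have "\<dots> = d * (n - 1)" using lt by simp
  finally show ?thesis .
qed

lemma sum_list_update_nat:
  fixes v :: "nat list"
  assumes "i < length v"
  shows "sum_list (v[i := b]) + v ! i = sum_list v + b"
  using sum_list_update[OF assms, of b] elem_le_sum_list[OF assms] by linarith

text \<open>A downward step lowers one coordinate \<open>v ! i\<close> to one of its \<open>v ! i\<close> smaller values.\<close>

lemma card_lower_nbrs_hamming_graph:
  assumes v: "v \<in> words n d"
  shows "card (lower_nbrs (hamming_graph n d) sum_list v) = sum_list v"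
proof -
  have len: "length v = d" and lt: "i < d \<Longrightarrow> v ! i < n" for i
    using v by (auto simp: words_def subset_iff)
  have less: "sum_list (v[i := b]) < sum_list v \<longleftrightarrow> b < v ! i" if "i < d" for i b
    using sum_list_update_nat[of i v b] that len by linarith
  have "lower_nbrs (hamming_graph n d) sum_list v = (\<lambda>(i, b). v[i := b]) ` (SIGMA i:{..<d}. {..<v ! i})"
    using lt less unfolding lower_nbrs_def nbrs_hamming_graph[OF v] by force
  also have "card \<dots> = card (SIGMA i:{..<d}. {..<v ! i})"
    by (intro card_image inj_on_subset[OF inj_on_list_update[OF len]]) auto
  also have "\<dots> = sum_list v" using len by (simp add: sum_list_sum_nth atLeast0LessThan)
  finally show ?thesis .
qed

lemma adjacent_imp_sum_list_neq:
  assumes "{u, v} \<in> edges (hamming_graph n d)"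
  shows "sum_list u \<noteq> sum_list v"
proof -
  obtain v' i b where *: "{u, v} = {v', v'[i := b]}" "v' \<in> words n d" "i < d" "b \<noteq> v' ! i"
    using assms by (auto simp: edges_hamming_graph)
  have "sum_list v' \<noteq> sum_list (v'[i := b])"
    using sum_list_update_nat[of i v' b] * by (auto simp: words_def)
  then show ?thesis using *(1) by (auto simp: doubleton_eq_iff)
qed

section \<open>Two sums over words\<close>

lemma sum_words_sum_list: "2 * (\<Sum>v\<in>words n d. sum_list v) = d * (n - 1) * n ^ d"
proof (induction d)
  case (Suc d)
  have "(\<Sum>v\<in>words n (Suc d). sum_list v) = n ^ d * (\<Sum>x<n. x) + n * (\<Sum>v\<in>words n d. sum_list v)"
    by (simp add: sum_words_Suc sum.distrib card_words sum_distrib_left)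
  moreover have "2 * (\<Sum>x<n. x) = n * (n - 1)"
  proof (induction n)
    case (Suc n)
    then show ?case by (cases n) simp_all
  qed simp
  ultimately have "2 * (\<Sum>v\<in>words n (Suc d). sum_list v) = n ^ d * (n * (n - 1)) + n * (d * (n - 1) * n ^ d)"
    using Suc by (metis distrib_left mult.left_commute)
  also have "\<dots> = Suc d * (n - 1) * n ^ Suc d" by (simp add: algebra_simps)
  finally show ?case .
qed (simp add: words_0)

text \<open>
  Splitting off the first letter turns the sum into a hockey-stick sum of binomial coefficients. The
  hypothesis \<open>s \<le> n\<close> makes sure that all first letters \<open>x < s\<close> occur.
\<close>

lemma sum_words_deficit:
  assumes "s \<le> n"
  shows "(\<Sum>v\<in>words n d. s - sum_list v) = (d + s) choose (d + 1)"
  using assms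
proof (induction d arbitrary: s)
  case 0
  then show ?case by (simp add: words_0)
next
  case (Suc d)
  have "(\<Sum>v\<in>words n (Suc d). s - sum_list v) = (\<Sum>x<n. \<Sum>v\<in>words n d. (s - x) - sum_list v)"
    by (simp add: sum_words_Suc)
  also have "\<dots> = (\<Sum>x<n. (d + (s - x)) choose (d + 1))"
    using Suc by (intro sum.cong refl Suc.IH) auto
  also have "\<dots> = (\<Sum>x<s. (d + (s - x)) choose (d + 1))"
    using Suc.prems by (intro sum.mono_neutral_right) auto
  also have "\<dots> = (Suc d + s) choose (Suc d + 1)"
    by (induction s) (simp_all add: sum.lessThan_Suc_shift del: sum.lessThan_Suc)
  finally show ?case .
qed

section \<open>The line arrangement of a Hamming graph\<close>

text \<open>
  The affine function attached to letter \<open>a\<close> in position \<open>i\<close> is \<open>\<ell>(t) = \<alpha>t - \<alpha>\<^sup>2\<close> (\<open>line i a\<close>), so that those with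
  slopes \<open>\<alpha> \<noteq> \<beta>\<close> agree precisely at \<open>t = \<alpha> + \<beta>\<close>. The slopes are distinct powers of two, one for each cell
  (position, letter); a sum of different slopes therefore determines its summands.
\<close>

definition cells :: "nat list \<Rightarrow> (nat \<times> nat) set" where
  "cells v = (\<lambda>i. (i, v ! i)) ` {..<length v}"

text \<open>
  For adjacent words the two sets of cells differ in one cell each, and \<open>meet\<close> is the parameter at
  which their lines intersect (\<open>meet_list_update\<close>). The symmetric difference makes it manifestly symmetric
  and total, and reduces its injectivity to uniqueness of binary expansions.
\<close>

definition meet :: "nat list \<Rightarrow> nat list \<Rightarrow> real" where
  "meet u v = (\<Sum>c\<in>sym_diff (cells u) (cells v). 2 ^ prod_encode c)"

definition slope :: "nat \<Rightarrow> nat \<Rightarrow> real" where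
  "slope i a = 2 ^ prod_encode (i, a)"

definition line :: "nat \<Rightarrow> nat \<Rightarrow> real poly" where
  "line i a = [:- (slope i a)\<^sup>2, slope i a:]"

text \<open>
  The restriction to \<open>L\<^sub>v\<close> of the Newton basis polynomial
  \<open>\<Prod>\<^sub>i \<Prod>\<^bsub>j < a\<^sub>i\<^esub> (y\<^sub>i - \<ell>\<^bsub>i,j\<^esub>(t))\<close> in the variables \<open>t, y\<^sub>1, \<dots>, y\<^sub>d\<close>, as a polynomial in \<open>t\<close>.
\<close>

definition newton_poly :: "nat list \<Rightarrow> nat list \<Rightarrow> real poly" where
  "newton_poly a v = (\<Prod>i<length a. \<Prod>j<a ! i. line i (v ! i) - line i j)"

lemma finite_cells: "finite (cells v)"
  by (simp add: cells_def)

lemma meet_eq_set_encode: "meet u v = real (set_encode (prod_encode ` sym_diff (cells u) (cells v)))"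
  unfolding meet_def set_encode_def by (subst sum.reindex) (auto intro: inj_prod_encode)

lemma meet_commute: "meet u v = meet v u"
  by (simp add: meet_def Un_commute)

lemma inj_on_meet: "inj_on (meet v) (words n d)"
proof (rule inj_onI)
  fix u u' assume u: "u \<in> words n d" "u' \<in> words n d" and eq: "meet v u = meet v u'"
  from eq have "prod_encode ` sym_diff (cells v) (cells u) = prod_encode ` sym_diff (cells v) (cells u')"
    by (simp add: meet_eq_set_encode set_encode_eq finite_cells)
  then have "sym_diff (cells v) (cells u) = sym_diff (cells v) (cells u')"
    by (simp add: inj_image_eq_iff inj_prod_encode)
  then have "cells u = cells u'" by blast
  then have "u ! i = u' ! i" if "i < d" for i
    using u that by (auto simp: cells_def words_def set_eq_iff image_iff)
  then show "u = u'" using u by (intro nth_equalityI) (auto simp: words_def)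
qed

lemma meet_list_update:
  assumes "i < length v" "b \<noteq> v ! i"
  shows "meet v (v[i := b]) = slope i (v ! i) + slope i b"
proof -
  have "sym_diff (cells v) (cells (v[i := b])) = {(i, v ! i), (i, b)}"
    using assms by (auto simp: cells_def nth_list_update image_iff split: if_splits)
  then show ?thesis using assms by (simp add: meet_def slope_def)
qed

lemma slope_inject: "slope i a = slope i b \<longleftrightarrow> a = b"
  by (simp add: slope_def)

text \<open>
  In the position where \<open>u\<close> and \<open>v\<close> differ, \<open>meet u v\<close> is the intersection parameter; in all other
  positions the two affine functions are equal.
\<close>

lemma line_agree:
  assumes "{u, v} \<in> edges (hamming_graph n d)" "j < d"
  shows "poly (line j (u ! j)) (meet u v) = poly (line j (v ! j)) (meet u v)"
proof -
  obtain w i b where *: "{u, v} = {w, w[i := b]}" "w \<in> words n d" "i < d" "b \<noteq> w ! i"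
    using assms by (auto simp: edges_hamming_graph)
  have len: "length w = d" using * by (simp add: words_def)
  have "poly (line j (w ! j)) (meet w (w[i := b])) = poly (line j (w[i := b] ! j)) (meet w (w[i := b]))"
    using * len assms(2)
    by (auto simp: meet_list_update line_def nth_list_update power2_eq_square algebra_simps)
  then show ?thesis using *(1) by (auto simp: doubleton_eq_iff meet_commute)
qed

lemma newton_poly_agree:
  assumes "{u, v} \<in> edges (hamming_graph n d)" "length a = d"
  shows "poly (newton_poly a u) (meet u v) = poly (newton_poly a v) (meet u v)"
proof -
  have "poly (line i (u ! i) - line i j) (meet u v) = poly (line i (v ! i) - line i j) (meet u v)"
    if "i < length a" for i j
    using line_agree[OF assms(1), of i] that assms(2) by simp
  then show ?thesis unfolding newton_poly_def poly_prod by (intro prod.cong refl) simp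
qed

lemma degree_newton_poly: "degree (newton_poly a v) \<le> sum_list a"
proof -
  have 1: "degree (line i x - line i y) \<le> 1" for i x y by (simp add: line_def)
  have "degree (newton_poly a v) \<le> (\<Sum>i<length a. degree (\<Prod>j<a ! i. line i (v ! i) - line i j))"
    unfolding newton_poly_def using degree_prod_sum_le[of "{..<length a}"] by (simp add: o_def)
  also have "\<dots> \<le> (\<Sum>i<length a. a ! i)"
  proof (intro sum_mono)
    fix i
    have "degree (\<Prod>j<a ! i. line i (v ! i) - line i j) \<le> (\<Sum>j<a ! i. degree (line i (v ! i) - line i j))"
      using degree_prod_sum_le[of "{..<a ! i}"] by (simp add: o_def)
    also have "\<dots> \<le> (\<Sum>j<a ! i. 1)" by (intro sum_mono 1)
    finally show "degree (\<Prod>j<a ! i. line i (v ! i) - line i j) \<le> a ! i" by simp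
  qed
  also have "\<dots> = sum_list a" by (simp add: sum_list_sum_nth atLeast0LessThan)
  finally show ?thesis .
qed

lemma newton_poly_self_nonzero: "newton_poly a a \<noteq> 0"
proof -
  have "line i x \<noteq> line i y" if "y < x" for i x y
    using that by (auto simp: line_def slope_inject)
  then show ?thesis by (auto simp: newton_poly_def)
qed

lemma newton_poly_eq_0:
  assumes "length a = length v" "i < length a" "v ! i < a ! i"
  shows "newton_poly a v = 0"
proof -
  have "(\<Prod>j<a ! i. line i (v ! i) - line i j) = 0" using assms(3) by (intro prod_zero) auto
  then show ?thesis unfolding newton_poly_def using assms(2) by (intro prod_zero) auto
qed

lemma ex_nth_less:
  fixes a v :: "nat list"
  assumes "length a = length v" "sum_list v \<le> sum_list a" "a \<noteq> v"
  obtains i where "i < length a" "v ! i < a ! i"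
proof (rule ccontr)
  assume neg: "\<not> thesis"
  have le: "\<forall>i<length a. a ! i \<le> v ! i"
  proof (intro allI impI, rule ccontr)
    fix i assume "i < length a" "\<not> a ! i \<le> v ! i"
    then show False using neg that by simp
  qed
  obtain j where j: "j < length a" "a ! j \<noteq> v ! j" using assms nth_equalityI by blast
  have "(\<Sum>i<length a. a ! i) < (\<Sum>i<length a. v ! i)"
  proof (rule sum_strict_mono_ex1)
    show "\<exists>i\<in>{..<length a}. a ! i < v ! i" using le j by (meson lessThan_iff le_neq_implies_less)
  qed (use le in auto)
  then show False using assms by (simp add: sum_list_sum_nth atLeast0LessThan)
qed

definition deficit_index :: "nat \<Rightarrow> nat \<Rightarrow> nat \<Rightarrow> (nat list \<times> nat) set" where
  "deficit_index n d s = (SIGMA a:words n d. {..<s - sum_list a})"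

lemma card_deficit_index: "card (deficit_index n d s) = (\<Sum>v\<in>words n d. s - sum_list v)"
  unfolding deficit_index_def by (simp add: finite_words)

text \<open>
  Triangularity: at the word \<open>a\<close>, every Newton polynomial of another index of at least the same
  coordinate sum vanishes, and those of smaller sum have coefficient zero by induction. What remains is a
  polynomial combination of powers of \<open>t\<close> times the nonzero polynomial \<open>newton_poly a a\<close>.
\<close>

lemma newton_family_independent:
  assumes zero: "\<And>v. v \<in> words n d \<Longrightarrow>
    (\<Sum>c\<in>deficit_index n d s. smult (z c) (monom 1 (snd c) * newton_poly (fst c) v)) = 0"
  shows "\<forall>c\<in>deficit_index n d s. z c = 0"
proof -
  have "\<forall>k<s - sum_list a. z (a, k) = 0" if "a \<in> words n d" for a
    using that
  proof (induction "sum_list a" arbitrary: a rule: less_induct)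
    case less
    let ?C = "deficit_index n d s"
    define q where "q = (\<Sum>k<s - sum_list a. monom (z (a, k)) k)"
    have fin: "finite ?C" unfolding deficit_index_def by (simp add: finite_words)
    have "(\<Sum>c\<in>?C. smult (z c) (monom 1 (snd c) * newton_poly (fst c) a))
        = (\<Sum>c\<in>{a} \<times> {..<s - sum_list a}. smult (z c) (monom 1 (snd c) * newton_poly (fst c) a))"
    proof (intro sum.mono_neutral_right fin)
      show "{a} \<times> {..<s - sum_list a} \<subseteq> ?C" using less.prems by (auto simp: deficit_index_def)
      show "\<forall>c\<in>?C - {a} \<times> {..<s - sum_list a}.
          smult (z c) (monom 1 (snd c) * newton_poly (fst c) a) = 0"
      proof
        fix c assume "c \<in> ?C - {a} \<times> {..<s - sum_list a}"
        then obtain a' k where c: "c = (a', k)"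
          and a': "a' \<in> words n d" "k < s - sum_list a'" "a' \<noteq> a"
          by (auto simp: deficit_index_def)
        show "smult (z c) (monom 1 (snd c) * newton_poly (fst c) a) = 0"
        proof (cases "sum_list a' < sum_list a")
          case True
          then show ?thesis using less.hyps a' c by simp
        next
          case False
          have len: "length a' = length a" using a' less.prems by (simp add: words_def)
          with False a' obtain i where "i < length a'" "a ! i < a' ! i"
            using ex_nth_less[of a' a] by (metis not_less)
          then show ?thesis using newton_poly_eq_0[OF len] c by simp
        qed
      qed
    qed
    also have "\<dots> = (\<Sum>k<s - sum_list a. monom (z (a, k)) k * newton_poly a a)"
      by (rule sum.reindex_cong[where l = "Pair a"])
        (auto simp: inj_on_def smult_monom simp flip: mult_smult_left)
    also have "\<dots> = q * newton_poly a a" by (simp add: q_def sum_distrib_right)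
    finally have "q = 0" using zero[OF less.prems] newton_poly_self_nonzero by simp
    moreover have "coeff q k = z (a, k)" if "k < s - sum_list a" for k
      using that by (simp add: q_def coeff_sum)
    ultimately show ?case by simp
  qed
  then show ?thesis by (auto simp: deficit_index_def)
qed

lemma hamming_percolating_lower_bound:
  assumes perc: "percolating (hamming_graph n d) r E0" and deg: "d * (n - 1) \<le> r + s"
  shows "card (edges (hamming_graph n d)) + (\<Sum>v\<in>words n d. s - sum_list v) \<le> s * n ^ d + card E0"
proof -
  let ?G = "hamming_graph n d"
  have "card (edges ?G) + card (deficit_index n d s) \<le> s * card (verts ?G) + card E0"
  proof (rule percolating_lower_bound[where x = meet
        and p = "\<lambda>c v. monom 1 (snd c) * newton_poly (fst c) v"])
    show "simple_graph ?G" by (rule simple_graph_hamming_graph)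
    show "percolating ?G r E0" by (rule perc)
    show "card (nbrs ?G v) \<le> r + s" if "v \<in> verts ?G" for v
      using that deg by (simp add: verts_hamming_graph card_nbrs_hamming_graph)
    show "inj_on (meet v) (nbrs ?G v)" for v
      using nbrs_subset_verts[OF simple_graph_hamming_graph] verts_hamming_graph
      by (metis inj_on_meet inj_on_subset)
    show "meet u v = meet v u" for u v by (rule meet_commute)
    show "finite (deficit_index n d s)" by (simp add: deficit_index_def finite_words)
    show "degree (monom 1 (snd c) * newton_poly (fst c) v) < s"
      if "c \<in> deficit_index n d s" for c and v
    proof -
      have "degree (monom (1::real) (snd c) * newton_poly (fst c) v) \<le> snd c + sum_list (fst c)"
        by (rule order_trans[OF degree_mult_le]) (simp add: degree_monom_eq degree_newton_poly)
      also have "\<dots> < s" using that by (auto simp: deficit_index_def)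
      finally show ?thesis .
    qed
    show "poly (monom 1 (snd c) * newton_poly (fst c) u) (meet u v)
        = poly (monom 1 (snd c) * newton_poly (fst c) v) (meet u v)"
      if "c \<in> deficit_index n d s" "{u, v} \<in> edges ?G" for c u v
      using that newton_poly_agree[OF that(2), of "fst c"] by (auto simp: deficit_index_def words_def)
    show "\<forall>c\<in>deficit_index n d s. z c = 0"
      if "\<And>v. v \<in> verts ?G \<Longrightarrow> (\<Sum>c\<in>deficit_index n d s.
            smult (z c) (monom 1 (snd c) * newton_poly (fst c) v)) = 0" for z
      using newton_family_independent[of n d z s] that by (simp add: verts_hamming_graph)
  qed
  then show ?thesis by (simp add: card_deficit_index verts_hamming_graph card_words)
qed

section \<open>The percolation number of Hamming graphs\<close>

lemma card_edges_hamming_graph: "card (edges (hamming_graph n d)) = (\<Sum>v\<in>words n d. sum_list v)"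
  using card_edges_eq_sum_lower[where w = sum_list,
      OF simple_graph_hamming_graph adjacent_imp_sum_list_neq[where n = n and d = d]]
  by (simp add: verts_hamming_graph card_lower_nbrs_hamming_graph)

text \<open>
  The two bounds match because \<open>(w - s) + s = w + (s - w)\<close> holds for truncated subtraction, with
  \<open>w\<close> the coordinate sum of a word. The subtracted terms are moved to the other side to stay in the
  natural numbers.
\<close>

lemma m_e_hamming_graph:
  assumes "r + s = d * (n - 1)"
  shows "m_e (hamming_graph n d) r + s * n ^ d
       = card (edges (hamming_graph n d)) + (\<Sum>v\<in>words n d. s - sum_list v)"
proof -
  let ?G = "hamming_graph n d"
  obtain E0 where E0: "percolating ?G r E0" "card E0 = (\<Sum>v\<in>words n d. sum_list v - s)"
    using exists_percolating_set[where G = ?G and w = sum_list and r = r and s = s,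
        OF simple_graph_hamming_graph adjacent_imp_sum_list_neq[where n = n and d = d]] assms
    by (auto simp: verts_hamming_graph card_nbrs_hamming_graph card_lower_nbrs_hamming_graph)
  have "card E0 + s * n ^ d = (\<Sum>v\<in>words n d. (sum_list v - s) + s)"
    using E0 by (simp add: sum.distrib card_words)
  also have "\<dots> = (\<Sum>v\<in>words n d. sum_list v + (s - sum_list v))"
    by (intro sum.cong) auto
  finally have eq: "card E0 + s * n ^ d = card (edges ?G) + (\<Sum>v\<in>words n d. s - sum_list v)"
    by (simp add: sum.distrib card_edges_hamming_graph)
  have "m_e ?G r = card E0"
    unfolding m_e_def
  proof (rule Min_eqI)
    show "finite {card E0 |E0. percolating ?G r E0}"
      by (rule m_e_set[OF simple_graph_hamming_graph])
    show "card E0 \<in> {card E0 |E0. percolating ?G r E0}" using E0 by blast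
    show "card E0 \<le> y" if y: "y \<in> {card E0 |E0. percolating ?G r E0}" for y
    proof -
      obtain E1 where "y = card E1" "percolating ?G r E1" using y by blast
      then show ?thesis using hamming_percolating_lower_bound[of n d r E1 s] assms eq by simp
    qed
  qed
  with eq show ?thesis by simp
qed

theorem lemma3p4:
  fixes n d r :: nat
  assumes "n \<ge> 2"
    and "(int n - 1) * (int d - 1) \<le> int r"
    and "int r \<le> (int n - 1) * int d"
  shows "real (m_e (hamming_graph n d) r) =
           real ((n * d - r) choose (d + 1)) + (real r - (real n - 1) * real d / 2) * real n ^ d"
proof -
  define s where "s = d * (n - 1) - r"
  have "int (d * (n - 1)) = (int n - 1) * int d" using assms(1) by (simp add: of_nat_diff)
  then have "r \<le> d * (n - 1)" and le: "int (d * (n - 1)) - int r \<le> int n - 1"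
    using assms(2,3) by (auto simp: algebra_simps simp del: of_nat_mult)
  then have s: "r + s = d * (n - 1)" by (simp add: s_def)
  then have "s \<le> n" using le by linarith
  have "n * d = d * (n - 1) + d" using assms(1) by (cases n) auto
  then have nd: "n * d - r = d + s" using s by simp
  have "m_e (hamming_graph n d) r + s * n ^ d
      = (\<Sum>v\<in>words n d. sum_list v) + ((n * d - r) choose (d + 1))"
    using m_e_hamming_graph[OF s] sum_words_deficit[OF \<open>s \<le> n\<close>, of d]
    by (simp add: card_edges_hamming_graph nd)
  then have "real (m_e (hamming_graph n d) r) + real s * real n ^ d
      = real (\<Sum>v\<in>words n d. sum_list v) + real ((n * d - r) choose (d + 1))"
    by (metis of_nat_add of_nat_mult of_nat_power)
  moreover have "2 * real (\<Sum>v\<in>words n d. sum_list v) = real d * (real n - 1) * real n ^ d"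
  proof -
    have "real (2 * (\<Sum>v\<in>words n d. sum_list v)) = real (d * (n - 1) * n ^ d)"
      by (simp only: sum_words_sum_list)
    then show ?thesis using assms(1) by (simp add: of_nat_diff)
  qed
  moreover have "real s = real d * (real n - 1) - real r"
  proof -
    have "real r + real s = real (d * (n - 1))" by (simp only: s flip: of_nat_add)
    then show ?thesis using assms(1) by (simp add: of_nat_diff)
  qed
  ultimately show ?thesis by (simp add: field_simps)
qed

end
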